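(* Let $b\ge 1$ and $r\ge 2$ be integers, let $\mathcal{O}^*=\{(jr+1)b : j\ge 0\}$ and $\mathcal{E}^*=\{jrb : j\ge 1\}$. Let $A\subseteq \mathcal{O}^*$ and $B\subseteq \mathcal{E}^*$ be such that $b\in A$ and $A\cup B$ is odd-ended (in the stretched sense). Define $(c_n)_{n\ge 0}$ by $$\left(1-\sum_{s \in A} \frac{x^{s}}{s!} + \sum_{t \in B} \frac{x^{t}}{t!}\right)^{-1} = \sum_{n \ge 0} c_n \frac{x^n}{n!}.$$ Then every $c_n$ is a non-negative integer, and moreover, for every $n\ge 0$, $c_n$ is the number of good ordered set partitions of $[n]=\{1,\ldots,n\}$.
   Context: Put $\mathbb{N}^*=\mathcal{O}^*\cup\mathcal{E}^*=\{b, rb, (r+1)b, 2rb, (2r+1)b,\ldots\}$, listed in increasing order; "intervals" are sets of consecutive elements of $\mathbb{N}^*$ in this order. Write $A\cup B$ as the disjoint union of its maximal intervals in $\mathbb{N}^*$ (possibly one infinite). $A\cup B$ is odd-ended if all (finite) endpoints of the maximal intervals lie in $\mathcal{O}^*$; equivalently, $krb\in B$ implies $(kr+1)b\in A$ and $((k-1)r+1)b\in A$. An element of $A\cup B$ is a top element if the next larger element of $\mathbb{N}^*$ is not in $A\cup B$, and a bottom element if it is the smallest element of $\mathbb{N}^*$ or the next smaller element of $\mathbb{N}^*$ is not in $A\cup B$. An ordered set partition of $[n]$ is a sequence $P=P_1/\cdots/P_\ell$ of pairwise disjoint nonempty sets (blocks) with union $[n]$ (exactly one, the empty one, if $n=0$).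 A sequence of consecutive blocks $P_i,P_{i+1},\ldots,P_j$ is collectively increasing if $\max P_{h}<\min P_{h+1}$ for $i\le h<j$. A unit block is a block of size $b$. Freeze skip $r$-tuples of $P$ are determined by scanning from right to left starting with $j=\ell$. When $P_j$ is considered: if $j\ge r$, the $r-1$ blocks $P_{j-r+2},\ldots,P_j$ are unit blocks, $|P_{j-r+1}|\in\mathcal{O}^*$ and $P_{j-r+1},\ldots,P_j$ are collectively increasing, then: if $|P_{j-r+1}|$ is a top element, $(P_{j-r+1},\ldots,P_j)$ is a freeze skip $r$-tuple and the scan continues with $P_{j-r}$; if $|P_{j-r+1}|$ is not a top element, the scan stops. In all other cases the scan continues with $P_{j-1}$. $P$ is good if: (1) every block size is either $b$ or an endpoint (top or bottom element) of a maximal interval of $A\cup B$; (2) every block whose size is a top element that is not a bottom element belongs to a freeze skip $r$-tuple; (3) no block $P_i$ whose size is a bottom element that is not a top element is immediately followed by $r-1$ unit blocks $P_{i+1},\ldots,P_{i+r-1}$ such that $P_i,\ldots,P_{i+r-1}$ are collectively increasing and none of $P_{i+1},\ldots,P_{i+r-1}$ is in a freeze skip $r$-tuple. *)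

theory Defs
  imports Complex_Main "HOL-Computational_Algebra.Formal_Power_Series" "HOL-Library.Disjoint_Sets"
begin

definition Ostar :: "nat \<Rightarrow> nat \<Rightarrow> nat set" where
  "Ostar b r = {(j * r + 1) * b | j. True}"

definition Estar :: "nat \<Rightarrow> nat \<Rightarrow> nat set" where
  "Estar b r = {j * r * b | j. 1 \<le> j}"

definition Nstar :: "nat \<Rightarrow> nat \<Rightarrow> nat set" where
  "Nstar b r = Ostar b r \<union> Estar b r"

text \<open>Intervals are nonempty sets of consecutive elements in the order of \<open>Nstar\<close>; they may be infinite.\<close>

definition star_interval :: "nat \<Rightarrow> nat \<Rightarrow> nat set \<Rightarrow> bool" where
  "star_interval b r I \<longleftrightarrow> I \<noteq> {} \<and> I \<subseteq> Nstar b r \<and>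
     (\<forall>x\<in>I. \<forall>y\<in>I. \<forall>z\<in>Nstar b r. x \<le> z \<and> z \<le> y \<longrightarrow> z \<in> I)"

definition maximal_interval :: "nat \<Rightarrow> nat \<Rightarrow> nat set \<Rightarrow> nat set \<Rightarrow> bool" where
  "maximal_interval b r S I \<longleftrightarrow> star_interval b r I \<and> I \<subseteq> S \<and>
     (\<forall>J. star_interval b r J \<and> J \<subseteq> S \<and> I \<subseteq> J \<longrightarrow> J = I)"

definition endpoint_of :: "nat set \<Rightarrow> nat \<Rightarrow> bool" where
  "endpoint_of I x \<longleftrightarrow> x \<in> I \<and> ((\<forall>y\<in>I. x \<le> y) \<or> (\<forall>y\<in>I. y \<le> x))"

definition odd_ended :: "nat \<Rightarrow> nat \<Rightarrow> nat set \<Rightarrow> bool" where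
  "odd_ended b r S \<longleftrightarrow> (\<forall>I x. maximal_interval b r S I \<and> endpoint_of I x \<longrightarrow> x \<in> Ostar b r)"

definition next_star :: "nat \<Rightarrow> nat \<Rightarrow> nat \<Rightarrow> nat" where
  "next_star b r x = (LEAST y. y \<in> Nstar b r \<and> x < y)"

definition prev_star :: "nat \<Rightarrow> nat \<Rightarrow> nat \<Rightarrow> nat" where
  "prev_star b r x = Max {y \<in> Nstar b r. y < x}"

definition top_element :: "nat \<Rightarrow> nat \<Rightarrow> nat set \<Rightarrow> nat \<Rightarrow> bool" where
  "top_element b r S x \<longleftrightarrow> x \<in> S \<and> next_star b r x \<notin> S"

definition bottom_element :: "nat \<Rightarrow> nat \<Rightarrow> nat set \<Rightarrow> nat \<Rightarrow> bool" where
  "bottom_element b r S x \<longleftrightarrow> x \<in> S \<and> (x = (LEAST y. y \<in> Nstar b r) \<or> prev_star b r x \<notin> S)"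

definition ordered_set_partition :: "nat \<Rightarrow> nat set list \<Rightarrow> bool" where
  "ordered_set_partition n P \<longleftrightarrow> distinct P \<and> partition_on {1..n} (set P)"

text \<open>The block \<open>P\<^sub>i\<close> of the mathematical text is \<open>P ! (i - 1)\<close>.
  Below, \<open>i\<close>, \<open>j\<close> delimit the half-open range of list positions \<open>i, \<dots>, j - 1\<close>,
  i.e. the blocks \<open>P\<^sub>i\<^sub>+\<^sub>1, \<dots>, P\<^sub>j\<close>.\<close>

definition coll_increasing :: "nat set list \<Rightarrow> nat \<Rightarrow> nat \<Rightarrow> bool" where
  "coll_increasing P i j \<longleftrightarrow> (\<forall>h. i \<le> h \<and> Suc h < j \<longrightarrow> Max (P ! h) < Min (P ! Suc h))"

definition unit_blocks :: "nat \<Rightarrow> nat set list \<Rightarrow> nat \<Rightarrow> nat \<Rightarrow> bool" where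
  "unit_blocks b P i j \<longleftrightarrow> (\<forall>h. i \<le> h \<and> h < j \<longrightarrow> card (P ! h) = b)"

text \<open>The condition, tested when \<open>P\<^sub>j\<close> is considered, on the \<open>r\<close> blocks ending with \<open>P\<^sub>j\<close>.\<close>

definition freeze_candidate :: "nat \<Rightarrow> nat \<Rightarrow> nat set list \<Rightarrow> nat \<Rightarrow> bool" where
  "freeze_candidate b r P j \<longleftrightarrow> r \<le> j \<and> unit_blocks b P (j - r + 1) j \<and>
     card (P ! (j - r)) \<in> Ostar b r \<and> coll_increasing P (j - r) j"

text \<open>The set of all \<open>j\<close> such that the scan, started at the given index, finds a freeze skip
  \<open>r\<close>-tuple whose last block is \<open>P\<^sub>j\<close>.  For \<open>r \<ge> 1\<close> the recursive argument \<open>j - (r - 1)\<close> is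
  \<open>Suc j - r\<close>; it is written so that termination does not depend on \<open>r \<ge> 1\<close>.\<close>

fun freeze_scan :: "nat \<Rightarrow> nat \<Rightarrow> nat set \<Rightarrow> nat set list \<Rightarrow> nat \<Rightarrow> nat set" where
  "freeze_scan b r S P 0 = {}"
| "freeze_scan b r S P (Suc j) =
     (if freeze_candidate b r P (Suc j) then
        (if top_element b r S (card (P ! (Suc j - r)))
         then insert (Suc j) (freeze_scan b r S P (j - (r - 1)))
         else {})
      else freeze_scan b r S P j)"

definition in_freeze_skip :: "nat \<Rightarrow> nat \<Rightarrow> nat set \<Rightarrow> nat set list \<Rightarrow> nat \<Rightarrow> bool" where
  "in_freeze_skip b r S P i \<longleftrightarrow> (\<exists>j \<in> freeze_scan b r S P (length P). j - r \<le> i \<and> i < j)"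

definition good :: "nat \<Rightarrow> nat \<Rightarrow> nat set \<Rightarrow> nat set list \<Rightarrow> bool" where
  "good b r S P \<longleftrightarrow>
     (\<forall>X \<in> set P. card X = b \<or> top_element b r S (card X) \<or> bottom_element b r S (card X)) \<and>
     (\<forall>i < length P. top_element b r S (card (P ! i)) \<and> \<not> bottom_element b r S (card (P ! i))
        \<longrightarrow> in_freeze_skip b r S P i) \<and>
     \<not> (\<exists>i. i + r \<le> length P \<and>
          bottom_element b r S (card (P ! i)) \<and> \<not> top_element b r S (card (P ! i)) \<and>
          unit_blocks b P (i + 1) (i + r) \<and> coll_increasing P i (i + r) \<and>
          (\<forall>h. i + 1 \<le> h \<and> h < i + r \<longrightarrow> \<not> in_freeze_skip b r S P h))"

definition egf :: "nat set \<Rightarrow> real fps" where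
  "egf S = Abs_fps (\<lambda>n. if n \<in> S then 1 / fact n else 0)"

lemma finite_ordered_set_partitions: "finite {P. ordered_set_partition n P}"
proof (rule finite_subset)
  show "{P. ordered_set_partition n P} \<subseteq> {P. set P \<subseteq> Pow {1..n} \<and> distinct P}"
    by (auto simp: ordered_set_partition_def partition_on_def)
  show "finite {P. set P \<subseteq> Pow {1..n} \<and> distinct P}"
    by (rule finite_subset_distinct) simp
qed

end

theory Submission
  imports Defs
begin

text \<open>
  Let \<open>N(V)\<close> be the number of good ordered partitions of a finite set \<open>V\<close>. It suffices that
  \<open>N(V) = (\<Sum>X. N(V - X)) - (\<Sum>Y. N(V - Y))\<close>, the sums ranging over \<open>X, Y \<subseteq> V\<close> with
  \<open>|X| \<in> A\<close> and \<open>|Y| \<in> B\<close>, since this is the recursion for \<open>c\<close>. Goodness is analysed by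
  removing the first block. In a good partition the scan never stops, so \<open>X / Q\<close> is good iff
  \<open>Q\<close> is good, \<open>|X|\<close> is a top or a bottom element, and, unless \<open>|X|\<close> is both, \<open>X\<close> starts a
  collectively increasing tuple with \<open>r - 1\<close> unfrozen unit blocks iff \<open>|X|\<close> is a top element.

  Let \<open>l(s, k)\<close> count the pairs \<open>(X, Q)\<close> with \<open>|X| = s\<close> and \<open>Q\<close> good such that \<open>X\<close> is followed
  by a run of exactly \<open>k\<close> unfrozen unit blocks continuing it increasingly; on good \<open>Q\<close> always
  \<open>k \<le> r - 1\<close>. Merging \<open>X\<close> with the first block of \<open>Q\<close> gives \<open>l(s, k + 1) = l(s + b, k)\<close> for
  \<open>k < r - 1\<close>. Writing \<open>o\<^sub>j = (jr + 1)b\<close>, \<open>e\<^sub>j = jrb\<close>, and \<open>T(s)\<close> for the sum of \<open>l(s, k)\<close> over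
  all \<open>k\<close>, this yields \<open>l(o\<^sub>j, r - 1) - l(o\<^sub>j\<^sub>-\<^sub>1, r - 1) = T(o\<^sub>j) - T(e\<^sub>j)\<close>, and summation by parts
  over \<open>j\<close> turns the count by first block into the recursion.
\<close>

section \<open>The freeze scan when a block is prepended\<close>

lemma unit_blocks_Cons_Suc [simp]:
  "unit_blocks b (X # Q) (Suc i) (Suc j) \<longleftrightarrow> unit_blocks b Q i j"
proof
  assume "unit_blocks b (X # Q) (Suc i) (Suc j)"
  then show "unit_blocks b Q i j"
    unfolding unit_blocks_def by (metis Suc_le_mono Suc_less_eq nth_Cons_Suc)
next
  assume *: "unit_blocks b Q i j"
  show "unit_blocks b (X # Q) (Suc i) (Suc j)"
    unfolding unit_blocks_def
  proof (intro allI impI)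
    fix h assume "Suc i \<le> h \<and> h < Suc j"
    then show "card ((X # Q) ! h) = b"
      using * by (cases h) (auto simp: unit_blocks_def)
  qed
qed

lemma coll_increasing_Cons_Suc [simp]:
  "coll_increasing (X # Q) (Suc i) (Suc j) \<longleftrightarrow> coll_increasing Q i j"
proof
  assume "coll_increasing (X # Q) (Suc i) (Suc j)"
  then show "coll_increasing Q i j"
    unfolding coll_increasing_def by (metis Suc_le_mono Suc_less_eq nth_Cons_Suc)
next
  assume *: "coll_increasing Q i j"
  show "coll_increasing (X # Q) (Suc i) (Suc j)"
    unfolding coll_increasing_def
  proof (intro allI impI)
    fix h assume "Suc i \<le> h \<and> Suc h < Suc j"
    then show "Max ((X # Q) ! h) < Min ((X # Q) ! Suc h)"
      using * by (cases h) (auto simp: coll_increasing_def)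
  qed
qed

lemma coll_increasing_Cons_0:
  assumes "1 \<le> k"
  shows "coll_increasing (X # Q) 0 (Suc k) \<longleftrightarrow> Max X < Min (Q ! 0) \<and> coll_increasing Q 0 k"
proof -
  have "coll_increasing (X # Q) 0 (Suc k) \<longleftrightarrow>
      Max X < Min (Q ! 0) \<and> coll_increasing (X # Q) (Suc 0) (Suc k)"
    using assms unfolding coll_increasing_def
    by (metis (no_types, lifting) One_nat_def Suc_less_eq Suc_le_eq le0 not_gr_zero nth_Cons_0 nth_Cons_Suc)
  then show ?thesis by simp
qed

text \<open>\<open>freeze_scan\<close> keeps only the ends of the tuples found. Here every position
  considered is recorded, including one at which the scan stops, because a tuple at the front is
  found only if the scan gets that far.\<close>

fun freeze_visits :: "nat \<Rightarrow> nat \<Rightarrow> nat set \<Rightarrow> nat set list \<Rightarrow> nat \<Rightarrow> nat set" where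
  "freeze_visits b r S P 0 = {}"
| "freeze_visits b r S P (Suc j) = insert (Suc j)
     (if freeze_candidate b r P (Suc j) then
        (if top_element b r S (card (P ! (Suc j - r))) then freeze_visits b r S P (j - (r - 1)) else {})
      else freeze_visits b r S P j)"

lemma freeze_visits_bounds: "j \<in> freeze_visits b r S P m \<Longrightarrow> 1 \<le> j \<and> j \<le> m"
  by (induction b r S P m rule: freeze_visits.induct) (fastforce split: if_splits)+

lemma freeze_scan_eq:
  "freeze_scan b r S P m =
     {j \<in> freeze_visits b r S P m. freeze_candidate b r P j \<and> top_element b r S (card (P ! (j - r)))}"
  by (induction b r S P m rule: freeze_visits.induct) auto

lemma in_freeze_skip_iff:
  "in_freeze_skip b r S P i \<longleftrightarrow> (\<exists>j \<in> freeze_visits b r S P (length P).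
     freeze_candidate b r P j \<and> top_element b r S (card (P ! (j - r))) \<and> j - r \<le> i \<and> i < j)"
  unfolding in_freeze_skip_def freeze_scan_eq by auto

text \<open>The scan moves leftwards, so it must have continued after the candidate \<open>j\<close>
  in order to meet \<open>i\<close>. At a candidate it continues only if the first size is a top
  element, and then it resumes at \<open>j - r\<close>.\<close>

lemma freeze_visits_after:
  assumes "i \<in> freeze_visits b r S P m" "j \<in> freeze_visits b r S P m" "i < j" "freeze_candidate b r P j"
    and "1 \<le> r"
  shows "top_element b r S (card (P ! (j - r))) \<and> i \<le> j - r"
  using assms
proof (induction b r S P m rule: freeze_visits.induct)
  case (2 b r S P m)
  have "i \<noteq> Suc m" using 2(4,5,6) freeze_visits_bounds[of j b r S P "Suc m"] by auto
  show ?case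
  proof (cases "j = Suc m")
    case True
    then show ?thesis using 2 \<open>i \<noteq> Suc m\<close>
      by (auto split: if_splits dest: freeze_visits_bounds)
  next
    case False
    then show ?thesis using 2 \<open>i \<noteq> Suc m\<close> by (auto split: if_splits)
  qed
qed simp

text \<open>A position is missed for one of two reasons, both covered by the second case: a tuple
  ending at \<open>j\<close> jumps across it, or the scan stops at \<open>j\<close> on a candidate
  whose first size is not a top element.\<close>

lemma freeze_visits_cases:
  assumes "1 \<le> k" "k \<le> m" "1 \<le> r"
  obtains "k \<in> freeze_visits b r S P m"
  | j where "j \<in> freeze_visits b r S P m" "freeze_candidate b r P j" "k < j"
      "top_element b r S (card (P ! (j - r))) \<longrightarrow> j - r < k"
proof -
  have "k \<in> freeze_visits b r S P m \<or> (\<exists>j \<in> freeze_visits b r S P m. freeze_candidate b r P j \<and> k < j \<and>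
      (top_element b r S (card (P ! (j - r))) \<longrightarrow> j - r < k))"
    using assms
  proof (induction b r S P m rule: freeze_visits.induct)
    case (2 b r S P m)
    have "Suc m - r = m - (r - 1)" using 2 by simp
    then consider "k = Suc m" | "k \<le> m" "freeze_candidate b r P (Suc m)"
        "top_element b r S (card (P ! (Suc m - r))) \<longrightarrow> Suc m - r < k"
      | "k \<le> m" "freeze_candidate b r P (Suc m)"
        "top_element b r S (card (P ! (Suc m - r)))" "k \<le> m - (r - 1)"
      | "k \<le> m" "\<not> freeze_candidate b r P (Suc m)"
      using 2(4) by (metis le_Suc_eq not_le)
    then show ?case
    proof cases
      case 3
      then show ?thesis using 2(1)[OF 3(2,3)] 2 by auto
    next
      case 4
      then show ?thesis using 2(2)[OF 4(2)] 2 by auto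
    qed auto
  qed simp
  then show ?thesis using that by blast
qed

lemma freeze_candidate_Cons:
  "r \<le> j \<Longrightarrow> freeze_candidate b r (X # Q) (Suc j) \<longleftrightarrow> freeze_candidate b r Q j"
  by (simp add: freeze_candidate_def Suc_diff_le)

text \<open>Whether \<open>i\<close> is reached depends only on the tests at positions beyond
  \<open>i\<close>. For \<open>i\<close> at least \<open>r\<close> these concern tuples that do not
  contain \<open>X\<close>, so they agree with the tests in \<open>Q\<close> one position
  earlier.\<close>

lemma freeze_visits_Cons:
  assumes "2 \<le> r" "r \<le> i"
  shows "i \<in> freeze_visits b r S (X # Q) (Suc m) \<longleftrightarrow> i - 1 \<in> freeze_visits b r S Q m"
proof (induction m rule: less_induct)
  case (less m)
  show ?case
  proof (cases m)
    case 0
    then show ?thesis using assms by simp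
  next
    case (Suc m')
    show ?thesis
    proof (cases "r \<le> m")
      case True
      have "Suc m' - (r - 1) = Suc (m' - (r - 1))" "Suc (Suc m') - r = Suc (Suc m' - r)"
        using True Suc assms by auto
      moreover have "i = Suc m \<longleftrightarrow> i - 1 = m" using assms by auto
      ultimately show ?thesis
        using Suc less[of m'] less[of "m' - (r - 1)"] freeze_candidate_Cons[of r m b X Q] True by auto
    next
      case False
      \<comment> \<open>Here \<open>Suc m\<close> is at most \<open>r\<close>, so the only position
        left for \<open>i\<close> is the start of the scan.\<close>
      have "i \<in> freeze_visits b r S (X # Q) (Suc m) \<longleftrightarrow> i = Suc m"
        using freeze_visits_bounds[of i b r S "X # Q" "Suc m"] False assms by auto
      moreover have "i - 1 \<in> freeze_visits b r S Q m \<longleftrightarrow> i - 1 = m"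
        using freeze_visits_bounds[of "i - 1" b r S Q m] False assms Suc by auto
      ultimately show ?thesis using assms by auto
    qed
  qed
qed

text \<open>Topness of \<open>card X\<close> is deliberately left open: the scan of
  \<open>X # Q\<close> reaches position \<open>r\<close>, which is position \<open>r - 1\<close> of
  \<open>Q\<close>, and finds a candidate there. A top size then gives a freeze tuple and any other
  size a stop, so both conditions on \<open>X\<close> can be phrased with it.\<close>

definition new_tuple :: "nat \<Rightarrow> nat \<Rightarrow> nat set \<Rightarrow> nat set \<Rightarrow> nat set list \<Rightarrow> bool" where
  "new_tuple b r S X Q \<longleftrightarrow> freeze_candidate b r (X # Q) r \<and> r - 1 \<in> freeze_visits b r S Q (length Q)"

lemma in_freeze_skip_Cons_0:
  assumes "2 \<le> r"
  shows "in_freeze_skip b r S (X # Q) 0 \<longleftrightarrow> new_tuple b r S X Q \<and> top_element b r S (card X)"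
proof -
  have "in_freeze_skip b r S (X # Q) 0 \<longleftrightarrow> r \<in> freeze_visits b r S (X # Q) (length (X # Q)) \<and>
     freeze_candidate b r (X # Q) r \<and> top_element b r S (card ((X # Q) ! 0))"
  proof
    assume "in_freeze_skip b r S (X # Q) 0"
    then obtain j where j: "j \<in> freeze_visits b r S (X # Q) (length (X # Q))"
      "freeze_candidate b r (X # Q) j" "top_element b r S (card ((X # Q) ! (j - r)))" "j - r = 0"
      unfolding in_freeze_skip_iff by (auto simp del: freeze_visits.simps)
    moreover have "j = r" using j by (simp add: freeze_candidate_def)
    ultimately show "r \<in> freeze_visits b r S (X # Q) (length (X # Q)) \<and>
     freeze_candidate b r (X # Q) r \<and> top_element b r S (card ((X # Q) ! 0))" by simp
  next
    assume "r \<in> freeze_visits b r S (X # Q) (length (X # Q)) \<and>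
     freeze_candidate b r (X # Q) r \<and> top_element b r S (card ((X # Q) ! 0))"
    then show "in_freeze_skip b r S (X # Q) 0" unfolding in_freeze_skip_iff
      using assms by (intro bexI[of _ r]) auto
  qed
  then show ?thesis
    using freeze_visits_Cons[OF assms, of r b S X Q "length Q"] by (auto simp: new_tuple_def)
qed

text \<open>Tuples ending beyond position \<open>r\<close> are shifted tuples of \<open>Q\<close>;
  the only other one ends at \<open>r\<close> and starts with \<open>X\<close>.\<close>

lemma in_freeze_skip_Cons_Suc:
  assumes "2 \<le> r"
  shows "in_freeze_skip b r S (X # Q) (Suc i) \<longleftrightarrow> in_freeze_skip b r S Q i \<or>
    (new_tuple b r S X Q \<and> top_element b r S (card X) \<and> Suc i < r)"
proof
  assume "in_freeze_skip b r S (X # Q) (Suc i)"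
  then obtain j where j: "j \<in> freeze_visits b r S (X # Q) (Suc (length Q))"
      "freeze_candidate b r (X # Q) j" "top_element b r S (card ((X # Q) ! (j - r)))" "j - r \<le> Suc i" "Suc i < j"
    unfolding in_freeze_skip_iff by auto
  have rj: "r \<le> j" using j by (simp add: freeze_candidate_def)
  have v: "j - 1 \<in> freeze_visits b r S Q (length Q)"
    using freeze_visits_Cons[OF assms rj] j by blast
  show "in_freeze_skip b r S Q i \<or>
    (new_tuple b r S X Q \<and> top_element b r S (card X) \<and> Suc i < r)"
  proof (cases "j = r")
    case True
    then show ?thesis using j v by (simp add: new_tuple_def)
  next
    case False
    then obtain j' where j': "j = Suc j'" "r \<le> j'" using rj by (cases j) auto
    then show ?thesis using j v freeze_candidate_Cons[of r j' b X Q]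
      unfolding in_freeze_skip_iff by (auto simp: Suc_diff_le intro!: bexI[of _ j'])
  qed
next
  assume "in_freeze_skip b r S Q i \<or>
    (new_tuple b r S X Q \<and> top_element b r S (card X) \<and> Suc i < r)"
  then show "in_freeze_skip b r S (X # Q) (Suc i)"
  proof
    assume "in_freeze_skip b r S Q i"
    then obtain j where j: "j \<in> freeze_visits b r S Q (length Q)"
      "freeze_candidate b r Q j" "top_element b r S (card (Q ! (j - r)))" "j - r \<le> i" "i < j"
      unfolding in_freeze_skip_iff by auto
    have "r \<le> j" using j by (simp add: freeze_candidate_def)
    then show ?thesis
      using j freeze_visits_Cons[OF assms, of "Suc j" b S X Q "length Q"] freeze_candidate_Cons[of r j b X Q]
      unfolding in_freeze_skip_iff by (auto simp: Suc_diff_le intro!: bexI[of _ "Suc j"])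
  next
    assume "new_tuple b r S X Q \<and> top_element b r S (card X) \<and> Suc i < r"
    then show ?thesis
      using freeze_visits_Cons[OF assms, of r b S X Q "length Q"]
      unfolding in_freeze_skip_iff by (auto simp: new_tuple_def intro!: bexI[of _ r])
  qed
qed

section \<open>The order on \<open>Nstar\<close> and odd-ended sets\<close>

locale odd_ended_set =
  fixes b r :: nat and S :: "nat set"
  assumes b_pos: "1 \<le> b" and r_ge_2: "2 \<le> r"
    and S_subset: "S \<subseteq> Nstar b r" and b_in_S: "b \<in> S"
    and odd_ended: "odd_ended b r S"
begin

text \<open>The increasing enumeration of \<open>Nstar\<close> is \<open>oelt 0\<close>,
  \<open>eelt 1\<close>, \<open>oelt 1\<close>, \<open>eelt 2\<close>, and so on. The value
  \<open>eelt 0 = 0\<close> lies outside it, but lets \<open>oelt j = eelt j + b\<close> hold for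
  all \<open>j\<close>.\<close>

definition oelt :: "nat \<Rightarrow> nat" where "oelt j = (j * r + 1) * b"
definition eelt :: "nat \<Rightarrow> nat" where "eelt j = j * r * b"

lemma eelt_Suc: "eelt (Suc j) = oelt j + (r - 1) * b"
proof -
  obtain q where q: "r = Suc q" using r_ge_2 by (cases r) auto
  show ?thesis unfolding eelt_def oelt_def unfolding q by (simp add: algebra_simps)
qed

lemma oelt_eq: "oelt j = eelt j + b"
  by (simp add: eelt_def oelt_def algebra_simps)

lemma in_Ostar_iff: "x \<in> Ostar b r \<longleftrightarrow> (\<exists>j. x = oelt j)"
  by (auto simp: Ostar_def oelt_def)

lemma in_Estar_iff: "x \<in> Estar b r \<longleftrightarrow> (\<exists>j. x = eelt (Suc j))"
proof
  assume "x \<in> Estar b r"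
  then obtain i where i: "x = i * r * b" "1 \<le> i" by (auto simp: Estar_def)
  then obtain j where "i = Suc j" by (cases i) auto
  then show "\<exists>j. x = eelt (Suc j)" using i unfolding eelt_def by blast
next
  assume "\<exists>j. x = eelt (Suc j)"
  then obtain j where "x = Suc j * r * b" unfolding eelt_def by blast
  then show "x \<in> Estar b r" unfolding Estar_def by (intro CollectI exI[of _ "Suc j"]) simp
qed

lemma in_Nstar_iff: "x \<in> Nstar b r \<longleftrightarrow> (\<exists>j. x = oelt j \<or> x = eelt (Suc j))"
  by (auto simp: Nstar_def in_Ostar_iff in_Estar_iff)

lemma oelt_less_eelt: "oelt j < eelt (Suc j)"
  using b_pos r_ge_2 by (simp add: eelt_Suc)

lemma eelt_less_oelt: "eelt j < oelt j"
  using b_pos by (simp add: oelt_eq)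

lemma eelt_mono: "i \<le> j \<Longrightarrow> eelt i \<le> eelt j"
  by (simp add: eelt_def)

lemma oelt_mono: "i \<le> j \<Longrightarrow> oelt i \<le> oelt j"
  by (simp add: oelt_def)

lemma oelt_gt: "j < oelt j"
proof -
  have "j * 1 * 1 \<le> j * r * b" using b_pos r_ge_2 by (intro mult_le_mono) auto
  then have "j \<le> eelt j" by (simp add: eelt_def)
  then show ?thesis using b_pos by (simp add: oelt_eq)
qed

lemma inj_oelt: "inj oelt"
  using b_pos r_ge_2 by (auto simp: inj_def oelt_def)

lemma inj_eelt: "inj eelt"
  using b_pos r_ge_2 by (auto simp: inj_def eelt_def)

lemma oelt_less_oelt_iff: "oelt i < oelt j \<longleftrightarrow> i < j"
  using b_pos r_ge_2 by (simp add: oelt_def)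

lemma eelt_less_eelt_iff: "eelt i < eelt j \<longleftrightarrow> i < j"
  using b_pos r_ge_2 by (simp add: eelt_def)

lemma eelt_less_oelt_iff: "eelt i < oelt j \<longleftrightarrow> i \<le> j"
proof
  assume "i \<le> j" then show "eelt i < oelt j"
    using eelt_mono[of i j] eelt_less_oelt[of j] by simp
next
  assume *: "eelt i < oelt j" show "i \<le> j"
  proof (rule ccontr)
    assume "\<not> i \<le> j" then show False
      using eelt_mono[of "Suc j" i] oelt_less_eelt[of j] * by simp
  qed
qed

lemma oelt_less_eelt_iff: "oelt i < eelt j \<longleftrightarrow> i < j"
proof
  assume "i < j" then show "oelt i < eelt j"
    using eelt_mono[of "Suc i" j] oelt_less_eelt[of i] by simp
next
  assume *: "oelt i < eelt j" show "i < j"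
  proof (rule ccontr)
    assume "\<not> i < j" then show False
      using oelt_mono[of j i] eelt_less_oelt[of j] * by simp
  qed
qed

lemma oelt_neq_eelt: "oelt i \<noteq> eelt j"
  using eelt_less_oelt_iff[of j i] oelt_less_eelt_iff[of i j] by linarith

lemmas star_less_iffs = oelt_less_oelt_iff eelt_less_eelt_iff eelt_less_oelt_iff oelt_less_eelt_iff

lemma star_le_iffs:
  "oelt i \<le> oelt j \<longleftrightarrow> i \<le> j" "eelt i \<le> eelt j \<longleftrightarrow> i \<le> j"
  "eelt i \<le> oelt j \<longleftrightarrow> i \<le> j" "oelt i \<le> eelt j \<longleftrightarrow> i < j"
  by (simp_all only: not_less[symmetric] star_less_iffs) (auto simp: not_less)

lemma next_star_oelt: "next_star b r (oelt j) = eelt (Suc j)"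
  unfolding next_star_def
  by (rule Least_equality) (auto simp: in_Nstar_iff star_less_iffs star_le_iffs)

lemma next_star_eelt: "next_star b r (eelt j) = oelt j"
  unfolding next_star_def
  by (rule Least_equality) (auto simp: in_Nstar_iff star_less_iffs star_le_iffs)

lemma prev_star_oelt: "prev_star b r (oelt (Suc j)) = eelt (Suc j)"
  unfolding prev_star_def
  by (rule Max_eqI) (auto simp: in_Nstar_iff star_less_iffs star_le_iffs)

lemma prev_star_eelt: "prev_star b r (eelt (Suc j)) = oelt j"
  unfolding prev_star_def
  by (rule Max_eqI) (auto simp: in_Nstar_iff star_less_iffs star_le_iffs)

lemma oelt_0: "oelt 0 = b"
  by (simp add: oelt_def)

lemma Least_Nstar: "(LEAST y. y \<in> Nstar b r) = b"
proof (rule Least_equality)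
  show "b \<in> Nstar b r" unfolding in_Nstar_iff using oelt_0 by metis
  fix y assume "y \<in> Nstar b r"
  then obtain j where "y = oelt j \<or> y = eelt (Suc j)" by (auto simp: in_Nstar_iff)
  then have "oelt 0 \<le> y" by (auto simp: star_le_iffs)
  then show "b \<le> y" by (simp add: oelt_0)
qed

text \<open>The maximal interval of \<open>S\<close> around an even element does not end there, so
  it extends beyond that element on both sides and, being convex, contains both neighbours.
  Odd-endedness enters the proof only through this lemma.\<close>

lemma eelt_neighbours:
  assumes "eelt (Suc j) \<in> S"
  shows "oelt (Suc j) \<in> S" "oelt j \<in> S"
proof -
  define x where "x = eelt (Suc j)"
  \<comment> \<open>The points of \<open>S\<close> joined to \<open>x\<close> without leaving
    \<open>S\<close> form the maximal interval containing \<open>x\<close>.\<close>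
  define I where "I = {y \<in> S. \<forall>z \<in> Nstar b r. min x y \<le> z \<and> z \<le> max x y \<longrightarrow> z \<in> S}"
  have xS: "x \<in> S" using assms x_def by simp
  have xI: "x \<in> I" unfolding I_def using xS le_antisym by fastforce
  have int: "star_interval b r I"
    unfolding star_interval_def
  proof (intro conjI ballI impI)
    show "I \<noteq> {}" using xI by auto
    show "I \<subseteq> Nstar b r" using S_subset by (auto simp: I_def)
    fix u v z assume uv: "u \<in> I" "v \<in> I" and z: "z \<in> Nstar b r" "u \<le> z \<and> z \<le> v"
    have *: "w \<in> S" if "w \<in> Nstar b r" "min x z \<le> w" "w \<le> max x z" for w
    proof (cases "w \<le> x")
      case True
      then have "min x u \<le> w \<and> w \<le> max x u" using that z by (auto simp: min_def max_def split: if_splits)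
      then show ?thesis using uv that by (auto simp: I_def)
    next
      case False
      then have "min x v \<le> w \<and> w \<le> max x v" using that z by (auto simp: min_def max_def split: if_splits)
      then show ?thesis using uv that by (auto simp: I_def)
    qed
    show "z \<in> I" unfolding I_def using * z by auto
  qed
  have max: "maximal_interval b r S I"
    unfolding maximal_interval_def
  proof (intro conjI allI impI)
    show "I \<subseteq> S" by (auto simp: I_def)
    fix J assume J: "star_interval b r J \<and> J \<subseteq> S \<and> I \<subseteq> J"
    have "y \<in> I" if y: "y \<in> J" for y
    proof -
      have "min x y \<in> J" "max x y \<in> J" using J xI y by (auto simp: min_def max_def)
      then have "z \<in> S" if "z \<in> Nstar b r" "min x y \<le> z" "z \<le> max x y" for z
        using J that unfolding star_interval_def by blast
      then show ?thesis using J y by (auto simp: I_def)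
    qed
    then show "J = I" using J by auto
  qed (rule int)
  have "x \<notin> Ostar b r" using oelt_neq_eelt by (metis in_Ostar_iff x_def)
  then have "\<not> endpoint_of I x" using odd_ended max unfolding odd_ended_def by blast
  then obtain u v where uv: "u \<in> I" "u < x" "v \<in> I" "x < v"
    using xI unfolding endpoint_of_def by (auto simp: not_le)
  then have uvN: "u \<in> Nstar b r" "v \<in> Nstar b r" using S_subset by (auto simp: I_def)
  have "u \<le> oelt j" using uvN(1) uv(2) by (auto simp: x_def in_Nstar_iff star_less_iffs star_le_iffs)
  then have "min x u \<le> oelt j \<and> oelt j \<le> max x u"
    using uv oelt_less_eelt[of j] by (simp add: x_def)
  moreover have "oelt j \<in> Nstar b r" "oelt (Suc j) \<in> Nstar b r" by (auto simp: in_Nstar_iff)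
  ultimately show "oelt j \<in> S" using uv(1) by (simp add: I_def)
  have "oelt (Suc j) \<le> v" using uvN(2) uv(4) by (auto simp: x_def in_Nstar_iff star_less_iffs star_le_iffs)
  then have "min x v \<le> oelt (Suc j) \<and> oelt (Suc j) \<le> max x v"
    using uv eelt_less_oelt[of "Suc j"] by (simp add: x_def)
  then show "oelt (Suc j) \<in> S"
    using uv(3) \<open>oelt (Suc j) \<in> Nstar b r\<close> by (simp add: I_def)
qed

abbreviation top_el :: "nat \<Rightarrow> bool" where "top_el \<equiv> top_element b r S"
abbreviation bot_el :: "nat \<Rightarrow> bool" where "bot_el \<equiv> bottom_element b r S"

lemma top_el_oelt: "top_el (oelt j) \<longleftrightarrow> oelt j \<in> S \<and> eelt (Suc j) \<notin> S"
  by (simp add: top_element_def next_star_oelt)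

lemma bot_el_oelt: "bot_el (oelt j) \<longleftrightarrow> oelt j \<in> S \<and> (j = 0 \<or> eelt j \<notin> S)"
proof (cases j)
  case 0
  then show ?thesis by (simp add: bottom_element_def Least_Nstar oelt_0)
next
  case (Suc i)
  then have "oelt j \<noteq> b" using inj_oelt oelt_0 by (metis injD nat.distinct(1))
  then show ?thesis using Suc by (simp add: bottom_element_def Least_Nstar prev_star_oelt)
qed

text \<open>An even element of \<open>S\<close> has both neighbours in \<open>S\<close>, so it can
  be neither a top nor, in the next lemma, a bottom element.\<close>

lemma top_el_Ostar: "top_el x \<Longrightarrow> x \<in> Ostar b r"
  using S_subset eelt_neighbours(1) unfolding top_element_def
  by (metis in_Nstar_iff in_Ostar_iff next_star_eelt subsetD)

lemma bot_el_Ostar: "bot_el x \<Longrightarrow> x \<in> Ostar b r"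
  using S_subset eelt_neighbours(2) unfolding bottom_element_def Least_Nstar
  by (metis in_Nstar_iff in_Ostar_iff prev_star_eelt oelt_0 subsetD)

lemma bot_el_b: "bot_el b"
  using b_in_S by (simp add: bottom_element_def Least_Nstar)

end

section \<open>Free runs and goodness read block by block\<close>

text \<open>On good partitions this is the length of the longest collectively increasing initial run
  of unfrozen unit blocks, see \<open>rec_good_run\<close>. The reset to 0 reflects that a unit
  block linked to \<open>r - 1\<close> unfrozen ones completes a freeze tuple and is thus frozen
  itself.\<close>

fun free_run :: "nat \<Rightarrow> nat \<Rightarrow> nat set list \<Rightarrow> nat" where
  "free_run b r [] = 0"
| "free_run b r (X # Q) =
     (let k = (if Q \<noteq> [] \<and> Max X < Min (hd Q) then free_run b r Q else 0)
      in if card X = b \<and> k < r - 1 then Suc k else 0)"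

definition linked_run :: "nat \<Rightarrow> nat \<Rightarrow> nat set \<Rightarrow> nat set list \<Rightarrow> nat" where
  "linked_run b r X Q = (if Q \<noteq> [] \<and> Max X < Min (hd Q) then free_run b r Q else 0)"

lemma free_run_Cons [simp]:
  "free_run b r (X # Q) =
     (if card X = b \<and> linked_run b r X Q < r - 1 then Suc (linked_run b r X Q) else 0)"
  by (simp add: linked_run_def Let_def)

declare free_run.simps(2) [simp del]

lemma free_run_le: "free_run b r P \<le> r - 1"
  by (cases P) auto

lemma linked_run_le: "linked_run b r X Q \<le> r - 1"
  using free_run_le[of b r Q] by (simp add: linked_run_def)

text \<open>Here \<open>k\<close> stands for the linked run behind a block of size \<open>s\<close>.
  A run of \<open>r - 1\<close> means that the block starts a candidate reached by the scan: forced
  for a top element that is not a bottom element, forbidden in the opposite case, and optional when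
  \<open>s\<close> is both.\<close>

definition admissible :: "nat \<Rightarrow> nat \<Rightarrow> nat set \<Rightarrow> nat \<Rightarrow> nat \<Rightarrow> bool" where
  "admissible b r S s k \<longleftrightarrow> (top_element b r S s \<or> bottom_element b r S s) \<and>
     (top_element b r S s \<and> \<not> bottom_element b r S s \<longrightarrow> r - 1 \<le> k) \<and>
     (bottom_element b r S s \<and> \<not> top_element b r S s \<longrightarrow> k < r - 1)"

fun rec_good :: "nat \<Rightarrow> nat \<Rightarrow> nat set \<Rightarrow> nat set list \<Rightarrow> bool" where
  "rec_good b r S [] \<longleftrightarrow> True"
| "rec_good b r S (X # Q) \<longleftrightarrow> rec_good b r S Q \<and> admissible b r S (card X) (linked_run b r X Q)"

context odd_ended_set
begin

abbreviation visits :: "nat set list \<Rightarrow> nat set" where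
  "visits P \<equiv> freeze_visits b r S P (length P)"
abbreviation candidate :: "nat set list \<Rightarrow> nat \<Rightarrow> bool" where
  "candidate \<equiv> freeze_candidate b r"
abbreviation frozen :: "nat set list \<Rightarrow> nat \<Rightarrow> bool" where
  "frozen \<equiv> in_freeze_skip b r S"

lemma frozen_iff: "frozen P i \<longleftrightarrow>
    (\<exists>j \<in> visits P. candidate P j \<and> top_el (card (P ! (j - r))) \<and> j - r \<le> i \<and> i < j)"
  by (rule in_freeze_skip_iff)

definition violation :: "nat set list \<Rightarrow> nat \<Rightarrow> bool" where
  "violation P i \<longleftrightarrow> i + r \<le> length P \<and> bot_el (card (P ! i)) \<and> \<not> top_el (card (P ! i)) \<and>
     unit_blocks b P (i + 1) (i + r) \<and> coll_increasing P i (i + r) \<and>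
     (\<forall>h. i + 1 \<le> h \<and> h < i + r \<longrightarrow> \<not> frozen P h)"

text \<open>As the least element of \<open>Nstar\<close>, the unit size \<open>b\<close> is itself a
  bottom element, which absorbs the alternative \<open>card X = b\<close>.\<close>

lemma good_iff: "good b r S P \<longleftrightarrow>
    (\<forall>X \<in> set P. top_el (card X) \<or> bot_el (card X)) \<and>
    (\<forall>i < length P. top_el (card (P ! i)) \<and> \<not> bot_el (card (P ! i)) \<longrightarrow> frozen P i) \<and>
    \<not> (\<exists>i. violation P i)"
  unfolding good_def violation_def using bot_el_b by (intro arg_cong2[where f = conj] ball_cong refl) auto

lemma violation_candidate: "violation P i \<Longrightarrow> candidate P (i + r)"
  using bot_el_Ostar by (simp add: violation_def freeze_candidate_def)

text \<open>A stop at \<open>j\<close> would violate the third condition. The first size would be a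
  bottom element, and no later block of the candidate could be frozen: a tuple ending before
  \<open>j\<close> is never found after a stop, one ending at \<open>j\<close> needs a top size, and
  one ending after \<open>j\<close> lies wholly to the right because the scan still visits
  \<open>j\<close>.\<close>

lemma good_no_stop:
  assumes "good b r S P" "j \<in> visits P" "candidate P j"
  shows "top_el (card (P ! (j - r)))"
proof (rule ccontr)
  assume nt: "\<not> top_el (card (P ! (j - r)))"
  have j: "r \<le> j" "j \<le> length P"
    using assms(3) freeze_visits_bounds[OF assms(2)] by (auto simp: freeze_candidate_def)
  then have "P ! (j - r) \<in> set P" using r_ge_2 by simp
  then have "bot_el (card (P ! (j - r)))" using assms(1) nt by (auto simp: good_iff)
  moreover have "\<not> frozen P h" if h: "j - r < h" "h < j" for h
  proof
    assume "frozen P h"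
    then obtain j' where j': "j' \<in> visits P" "candidate P j'" "top_el (card (P ! (j' - r)))"
      "j' - r \<le> h" "h < j'" unfolding frozen_iff by blast
    consider "j' < j" | "j' = j" | "j < j'" by linarith
    then show False
    proof cases
      case 1
      then show ?thesis
        using freeze_visits_after[OF j'(1) assms(2) 1 assms(3)] nt r_ge_2 by auto
    next
      case 2
      then show ?thesis using j' nt by simp
    next
      case 3
      then show ?thesis
        using freeze_visits_after[OF assms(2) j'(1) 3 j'(2)] j' h r_ge_2 by auto
    qed
  qed
  ultimately have "violation P (j - r)"
    unfolding violation_def using nt j assms(3) by (auto simp: freeze_candidate_def)
  then show False using assms(1) by (auto simp: good_iff)
qed

text \<open>Since a good partition never stops the scan, a position is reached unless it is jumped over.\<close>

lemma new_tuple_iff: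
  assumes "good b r S Q"
  shows "new_tuple b r S X Q \<longleftrightarrow>
    r - 1 \<le> length Q \<and> candidate (X # Q) r \<and> (\<forall>i < r - 1. \<not> frozen Q i)"
proof
  assume *: "new_tuple b r S X Q"
  then have v: "r - 1 \<in> visits Q" by (simp add: new_tuple_def)
  have "\<not> frozen Q i" if i: "i < r - 1" for i
  proof
    assume "frozen Q i"
    then obtain j where j: "j \<in> visits Q" "candidate Q j" "top_el (card (Q ! (j - r)))"
      "j - r \<le> i" "i < j" unfolding frozen_iff by blast
    then have "r - 1 < j" using r_ge_2 by (auto simp: freeze_candidate_def)
    then show False using freeze_visits_after[OF v j(1) _ j(2)] j i r_ge_2 by auto
  qed
  then show "r - 1 \<le> length Q \<and> candidate (X # Q) r \<and> (\<forall>i < r - 1. \<not> frozen Q i)"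
    using * freeze_visits_bounds[OF v] by (simp add: new_tuple_def)
next
  assume *: "r - 1 \<le> length Q \<and> candidate (X # Q) r \<and> (\<forall>i < r - 1. \<not> frozen Q i)"
  have "1 \<le> r - 1" "r - 1 \<le> length Q" "1 \<le> r" using * r_ge_2 by auto
  then have "r - 1 \<in> visits Q"
  proof (cases rule: freeze_visits_cases[where b = b and r = r and S = S and P = Q])
    case (2 j)
    then have "top_el (card (Q ! (j - r)))" using good_no_stop[OF assms] by blast
    then have "frozen Q (j - r)" "j - r < r - 1"
      using 2 r_ge_2 unfolding frozen_iff by (auto simp: freeze_candidate_def intro!: bexI[of _ j])
    then show ?thesis using * by blast
  qed
  then show "new_tuple b r S X Q" using * by (simp add: new_tuple_def)
qed

lemma frozen_Cons_0: "frozen (X # Q) 0 \<longleftrightarrow> new_tuple b r S X Q \<and> top_el (card X)"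
  by (rule in_freeze_skip_Cons_0[OF r_ge_2])

lemma frozen_Cons_Suc: "frozen (X # Q) (Suc i) \<longleftrightarrow>
    frozen Q i \<or> (new_tuple b r S X Q \<and> top_el (card X) \<and> Suc i < r)"
  by (rule in_freeze_skip_Cons_Suc[OF r_ge_2])

text \<open>Only a new tuple at the front could repair a violation in \<open>Q\<close>, and the
  violation prevents it. If the scan visits \<open>i + r\<close> it stops there; if it jumps across
  \<open>i + r\<close>, the last block of the violating tuple is frozen, which a violation excludes.
  Goodness of \<open>Q\<close> is not assumed.\<close>

lemma violation_Cons_Suc:
  "violation (X # Q) (Suc i) \<longleftrightarrow> violation Q i"
proof
  assume *: "violation (X # Q) (Suc i)"
  have "\<not> frozen Q h" if "i + 1 \<le> h" "h < i + r" for h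
    using * that frozen_Cons_Suc[of X Q h] unfolding violation_def by auto
  then show "violation Q i" using * by (auto simp: violation_def)
next
  assume *: "violation Q i"
  have no_new: "\<not> new_tuple b r S X Q"
  proof
    assume "new_tuple b r S X Q"
    then have v: "r - 1 \<in> visits Q" by (simp add: new_tuple_def)
    have "1 \<le> i + r" "i + r \<le> length Q" "1 \<le> r"
      using * r_ge_2 by (auto simp: violation_def)
    then show False
    proof (cases rule: freeze_visits_cases[where b = b and r = r and S = S and P = Q])
      case 1
      then show ?thesis
        using freeze_visits_after[OF v 1 _ violation_candidate[OF *]] * r_ge_2
        by (simp add: violation_def)
    next
      case (2 j)
      have "top_el (card (Q ! (j - r)))"
        using freeze_visits_after[OF v 2(1) _ 2(2)] 2 r_ge_2 by simp
      then have "frozen Q (i + r - 1)"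
        using 2 r_ge_2 unfolding frozen_iff by (intro bexI[of _ j]) auto
      then show ?thesis using * r_ge_2 by (auto simp: violation_def)
    qed
  qed
  have "\<not> frozen (X # Q) h" if h: "Suc i + 1 \<le> h" "h < Suc i + r" for h
  proof -
    obtain h' where "h = Suc h'" using h by (cases h) auto
    then show ?thesis using h * no_new frozen_Cons_Suc[of X Q h'] by (auto simp: violation_def)
  qed
  then show "violation (X # Q) (Suc i)" using * by (auto simp: violation_def)
qed

lemma good_Cons:
  "good b r S (X # Q) \<longleftrightarrow> good b r S Q \<and> (top_el (card X) \<or> bot_el (card X)) \<and>
     (top_el (card X) \<and> \<not> bot_el (card X) \<longrightarrow> new_tuple b r S X Q) \<and>
     (bot_el (card X) \<and> \<not> top_el (card X) \<longrightarrow> \<not> new_tuple b r S X Q)"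
proof -
  have all_nat: "(\<forall>i. p i) \<longleftrightarrow> p 0 \<and> (\<forall>i. p (Suc i))" for p :: "nat \<Rightarrow> bool"
    by (metis nat.exhaust)
  have tops: "(\<forall>i < length (X # Q). top_el (card ((X # Q) ! i)) \<and> \<not> bot_el (card ((X # Q) ! i)) \<longrightarrow>
        frozen (X # Q) i) \<longleftrightarrow>
      (top_el (card X) \<and> \<not> bot_el (card X) \<longrightarrow> new_tuple b r S X Q) \<and>
      (\<forall>i < length Q. top_el (card (Q ! i)) \<and> \<not> bot_el (card (Q ! i)) \<longrightarrow> frozen Q i)"
  proof -
    \<comment> \<open>Within \<open>Q\<close> a new tuple freezes only unit blocks, and their size
      is a bottom element, so the second condition for blocks of \<open>Q\<close> is
      unaffected.\<close>
    have "frozen (X # Q) (Suc i) \<longleftrightarrow> frozen Q i" if "\<not> bot_el (card (Q ! i))" for i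
    proof -
      have False if "new_tuple b r S X Q" "Suc i < r"
      proof -
        have "unit_blocks b (X # Q) 1 r"
          using that by (simp add: new_tuple_def freeze_candidate_def)
        then have "card (Q ! i) = b" using that(2) by (auto simp: unit_blocks_def dest: spec[of _ "Suc i"])
        then show False using \<open>\<not> bot_el (card (Q ! i))\<close> bot_el_b by simp
      qed
      then show ?thesis using frozen_Cons_Suc by blast
    qed
    then show ?thesis
      by (subst all_nat) (auto simp: frozen_Cons_0)
  qed
  have viol: "(\<exists>i. violation (X # Q) i) \<longleftrightarrow> violation (X # Q) 0 \<or> (\<exists>i. violation Q i)"
    using all_nat[of "\<lambda>i. \<not> violation (X # Q) i"] by (auto simp: violation_Cons_Suc)
  \<comment> \<open>If \<open>card X\<close> is not a top element, prepending \<open>X\<close>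
    freezes nothing, so the condition on unfrozen blocks is the one in
    \<open>new_tuple_iff\<close>.\<close>
  have viol0: "violation (X # Q) 0 \<longleftrightarrow> bot_el (card X) \<and> \<not> top_el (card X) \<and> new_tuple b r S X Q"
    if Q: "good b r S Q"
  proof (cases "bot_el (card X) \<and> \<not> top_el (card X)")
    case True
    have "(\<forall>h. 1 \<le> h \<and> h < r \<longrightarrow> \<not> frozen (X # Q) h) \<longleftrightarrow> (\<forall>i < r - 1. \<not> frozen Q i)"
      using True by (subst all_nat) (auto simp: frozen_Cons_Suc)
    then show ?thesis
      using True r_ge_2 bot_el_Ostar[of "card X"] unfolding new_tuple_iff[OF Q]
      by (auto simp: violation_def freeze_candidate_def)
  next
    case False
    then show ?thesis by (auto simp: violation_def)
  qed
  show ?thesis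
    using viol0 unfolding good_iff[of "X # Q"] tops viol
    unfolding good_iff[of Q] by auto
qed

text \<open>Both claims are proved together, since goodness of \<open>X # Q\<close> is decided by
  the free run of \<open>Q\<close>, whose meaning is available only for good \<open>Q\<close>.
  Quantifying over \<open>k\<close> characterises \<open>free_run\<close> as a maximal
  length.\<close>

lemma rec_good_run:
  "(good b r S P \<longleftrightarrow> rec_good b r S P) \<and>
   (good b r S P \<longrightarrow> (\<forall>k. k \<le> free_run b r P \<longleftrightarrow>
      k \<le> length P \<and> unit_blocks b P 0 k \<and> coll_increasing P 0 k \<and> (\<forall>i<k. \<not> frozen P i)))"
proof (induction P)
  case Nil
  show ?case
    using r_ge_2 by (auto simp: good_iff violation_def unit_blocks_def coll_increasing_def)
next
  case (Cons X Q)
  have run: "k \<le> linked_run b r X Q \<longleftrightarrow> k \<le> length Q \<and> unit_blocks b Q 0 k \<and>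
      coll_increasing (X # Q) 0 (Suc k) \<and> (\<forall>i<k. \<not> frozen Q i)" if "good b r S Q" for k
  proof (cases "k = 0")
    case True
    then show ?thesis by (simp add: unit_blocks_def coll_increasing_def)
  next
    case False
    then have "1 \<le> k" by simp
    have "k \<le> linked_run b r X Q \<longleftrightarrow> Q \<noteq> [] \<and> Max X < Min (Q ! 0) \<and> k \<le> free_run b r Q"
      using False by (auto simp: linked_run_def hd_conv_nth)
    moreover have "k \<le> length Q \<longrightarrow> Q \<noteq> []" using False by auto
    ultimately show ?thesis
      using Cons that coll_increasing_Cons_0[OF \<open>1 \<le> k\<close>] by auto
  qed
  have new: "new_tuple b r S X Q \<longleftrightarrow> r - 1 \<le> linked_run b r X Q"
    if "good b r S Q" "card X \<in> Ostar b r"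
  proof -
    have "r = Suc (r - 1)" using r_ge_2 by simp
    then have "candidate (X # Q) r \<longleftrightarrow> unit_blocks b Q 0 (r - 1) \<and> coll_increasing (X # Q) 0 (Suc (r - 1))"
      using that(2) unit_blocks_Cons_Suc[of b X Q 0 "r - 1"] by (simp add: freeze_candidate_def)
    then show ?thesis unfolding new_tuple_iff[OF that(1)] run[OF that(1)] by blast
  qed
  have eq: "good b r S (X # Q) \<longleftrightarrow> rec_good b r S (X # Q)"
    unfolding good_Cons using Cons new top_el_Ostar bot_el_Ostar
    by (auto simp: admissible_def not_le)
  have "k \<le> free_run b r (X # Q) \<longleftrightarrow> k \<le> length (X # Q) \<and> unit_blocks b (X # Q) 0 k \<and>
      coll_increasing (X # Q) 0 k \<and> (\<forall>i<k. \<not> frozen (X # Q) i)" if g: "good b r S (X # Q)" for k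
  proof (cases k)
    case 0
    then show ?thesis by (simp add: unit_blocks_def coll_increasing_def)
  next
    case (Suc m)
    have gQ: "good b r S Q" using g good_Cons by blast
    have all_less: "(\<forall>i<Suc m. p i) \<longleftrightarrow> p 0 \<and> (\<forall>i<m. p (Suc i))" for p :: "nat \<Rightarrow> bool"
      by (metis Suc_less_eq less_Suc_eq_0_disj)
    have units: "unit_blocks b (X # Q) 0 (Suc m) \<longleftrightarrow> card X = b \<and> unit_blocks b Q 0 m"
      using all_less[of "\<lambda>i. card ((X # Q) ! i) = b"] by (simp add: unit_blocks_def)
    show ?thesis
    proof (cases "card X = b \<and> linked_run b r X Q < r - 1")
      case True
      then have "\<not> new_tuple b r S X Q"
        using new[OF gQ] bot_el_Ostar[OF bot_el_b] by simp
      then have "(\<forall>i<Suc m. \<not> frozen (X # Q) i) \<longleftrightarrow> (\<forall>i<m. \<not> frozen Q i)"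
        by (subst all_less) (simp add: frozen_Cons_0 frozen_Cons_Suc)
      then show ?thesis using True run[OF gQ, of m] units Suc by auto
    next
      case False
      \<comment> \<open>A unit block followed by a full run would violate the third condition unless
        \<open>b\<close> is a top element. Hence it is frozen, and the free run is empty.\<close>
      have "frozen (X # Q) 0" if "card X = b"
      proof -
        have "new_tuple b r S X Q" using False that new[OF gQ] bot_el_Ostar[OF bot_el_b] by simp
        moreover have "top_el (card X)" using g that bot_el_b \<open>new_tuple b r S X Q\<close> unfolding good_Cons by auto
        ultimately show ?thesis by (simp add: frozen_Cons_0)
      qed
      then show ?thesis using False Suc units by auto
    qed
  qed
  then show ?case using eq by blast
qed

lemma good_iff_rec_good: "good b r S P \<longleftrightarrow> rec_good b r S P"
  using rec_good_run by blast

end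

section \<open>Initial segments and ordered partitions of finite sets\<close>

lemma obtain_initial_segment:
  fixes Y :: "nat set"
  assumes "finite Y" "s \<le> card Y"
  obtains X where "X \<subseteq> Y" "card X = s" "\<And>x y. x \<in> X \<Longrightarrow> y \<in> Y - X \<Longrightarrow> x < y"
proof -
  have "\<exists>X \<subseteq> Y. card X = s \<and> (\<forall>x \<in> X. \<forall>y \<in> Y - X. x < y)"
    using assms(2)
  proof (induction s)
    case 0
    then show ?case by (intro exI[of _ "{}"]) auto
  next
    case (Suc s)
    then obtain X where X: "X \<subseteq> Y" "card X = s" "\<forall>x \<in> X. \<forall>y \<in> Y - X. x < y" by auto
    have fin: "finite X" "finite (Y - X)" using X(1) assms(1) finite_subset by auto
    have ne: "Y - X \<noteq> {}"
    proof
      assume "Y - X = {}"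
      then have "Y = X" using X(1) by auto
      then show False using X(2) Suc.prems by simp
    qed
    define m where "m = Min (Y - X)"
    have m: "m \<in> Y - X" "\<forall>y \<in> Y - X. m \<le> y" using Min_in[OF fin(2) ne] fin(2) by (auto simp: m_def)
    have "m < y" if "y \<in> Y - insert m X" for y using m that by (metis Diff_iff insertCI le_neq_implies_less)
    then have "\<forall>x \<in> insert m X. \<forall>y \<in> Y - insert m X. x < y" using X(3) by auto
    then show ?case using X(1,2) m(1) fin(1) by (intro exI[of _ "insert m X"]) auto
  qed
  then show ?thesis using that by blast
qed

text \<open>Distinct sets of equal size each have a point outside the other; these two points would
  have to be smaller than one another.\<close>

lemma initial_segment_unique:
  fixes X X' :: "nat set"
  assumes "finite X" "finite X'" "card X = card X'" "X \<union> U = X' \<union> U'"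
    and "\<forall>x \<in> X. \<forall>y \<in> U. x < y" "\<forall>x \<in> X'. \<forall>y \<in> U'. x < y"
  shows "X = X'"
proof (rule ccontr)
  assume "X \<noteq> X'"
  then have "\<not> X \<subseteq> X'" "\<not> X' \<subseteq> X" using assms(1-3) card_subset_eq by metis+
  then obtain x y where "x \<in> X" "x \<notin> X'" "y \<in> X'" "y \<notin> X" by auto
  then have "x \<in> U'" "y \<in> U" using assms(4) by auto
  then show False using assms(5,6) \<open>x \<in> X\<close> \<open>y \<in> X'\<close> by force
qed

text \<open>Removing the first block leaves an arbitrary finite set, so \<open>{1..n}\<close> is
  replaced by \<open>V\<close>.\<close>

definition osp :: "nat set \<Rightarrow> nat set list \<Rightarrow> bool" where
  "osp V P \<longleftrightarrow> distinct P \<and> partition_on V (set P)"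

lemma ordered_set_partition_eq_osp: "ordered_set_partition n P \<longleftrightarrow> osp {1..n} P"
  by (simp add: ordered_set_partition_def osp_def)

lemma osp_Nil [simp]: "osp V [] \<longleftrightarrow> V = {}"
  by (auto simp: osp_def partition_on_def)

lemma osp_Cons [simp]: "osp V (X # Q) \<longleftrightarrow> X \<noteq> {} \<and> X \<subseteq> V \<and> osp (V - X) Q"
proof
  assume *: "osp V (X # Q)"
  then have "disjnt X (\<Union>(set Q))"
    unfolding osp_def partition_on_def disjoint_def disjnt_def by fastforce
  then show "X \<noteq> {} \<and> X \<subseteq> V \<and> osp (V - X) Q"
    using * by (auto simp: osp_def partition_on_insert)
next
  assume *: "X \<noteq> {} \<and> X \<subseteq> V \<and> osp (V - X) Q"
  then have U: "\<Union>(set Q) = V - X" by (auto simp: osp_def partition_on_def)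
  then have "disjnt X (\<Union>(set Q))" by (auto simp: disjnt_def)
  moreover have "X \<notin> set Q" using U * by blast
  ultimately show "osp V (X # Q)" using * by (auto simp: osp_def partition_on_insert)
qed

lemma finite_osp: "finite V \<Longrightarrow> finite {P. osp V P}"
proof (rule finite_subset)
  show "{P. osp V P} \<subseteq> {P. set P \<subseteq> Pow V \<and> distinct P}"
    by (auto simp: osp_def partition_on_def)
  show "finite V \<Longrightarrow> finite {P. set P \<subseteq> Pow V \<and> distinct P}"
    by (rule finite_subset_distinct) simp
qed

section \<open>Pairs counted by block size and run length\<close>

context odd_ended_set
begin

definition good_osps :: "nat set \<Rightarrow> nat set list set" where
  "good_osps V = {P. osp V P \<and> rec_good b r S P}"

lemma finite_good_osps: "finite V \<Longrightarrow> finite (good_osps V)"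
  unfolding good_osps_def by (rule finite_subset[OF _ finite_osp[of V]]) auto

text \<open>Only \<open>Q\<close> has to be good: \<open>X\<close> need not be admissible, and even
  sizes \<open>s\<close> are wanted as well.\<close>

definition pairs :: "nat set \<Rightarrow> nat \<Rightarrow> (nat set \<times> nat set list) set" where
  "pairs V s = (SIGMA X : {X. X \<subseteq> V \<and> card X = s}. good_osps (V - X))"

definition run_pairs :: "nat set \<Rightarrow> nat \<Rightarrow> nat \<Rightarrow> (nat set \<times> nat set list) set" where
  "run_pairs V s k = {(X, Q) \<in> pairs V s. linked_run b r X Q = k}"

lemma finite_pairs: "finite V \<Longrightarrow> finite (pairs V s)"
  unfolding pairs_def by (intro finite_SigmaI) (auto intro: finite_good_osps)

lemma finite_run_pairs: "finite V \<Longrightarrow> finite (run_pairs V s k)"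
  unfolding run_pairs_def by (rule finite_subset[OF _ finite_pairs[of V s]]) auto

lemma rec_good_unit_Cons:
  assumes "card U = b" "linked_run b r U R < r - 1"
  shows "rec_good b r S (U # R) \<longleftrightarrow> rec_good b r S R"
  using assms bot_el_b by (auto simp: admissible_def)

text \<open>The bijection merges \<open>X\<close> with the unit block that follows it; its inverse
  cuts off the \<open>s\<close> smallest elements of the merged block. As \<open>k < r - 1\<close>,
  the unit block cut off is admissible in front of the rest and lengthens the run by one.\<close>

lemma card_run_pairs_merge:
  assumes V: "finite V" and s: "1 \<le> s" and k: "k < r - 1"
  shows "card (run_pairs V s (Suc k)) = card (run_pairs V (s + b) k)"
proof -
  define f where "f = (\<lambda>(X :: nat set, Q). (X \<union> hd Q, tl Q :: nat set list))"
  have dom: "\<exists>U R. Q = U # R \<and> card U = b \<and> Max X < Min U \<and> linked_run b r U R = k \<and>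
      X \<subseteq> V \<and> card X = s \<and> U \<subseteq> V - X \<and> osp (V - X - U) R \<and> rec_good b r S R"
    if "(X, Q) \<in> run_pairs V s (Suc k)" for X Q
  proof -
    have l: "linked_run b r X Q = Suc k" "X \<subseteq> V" "card X = s" "osp (V - X) Q" "rec_good b r S Q"
      using that by (auto simp: run_pairs_def pairs_def good_osps_def)
    then obtain U R where Q: "Q = U # R" by (cases Q) (auto simp: linked_run_def)
    then have "Max X < Min U" "free_run b r (U # R) = Suc k"
      using l(1) by (auto simp: linked_run_def split: if_splits)
    then show ?thesis using l Q by (auto split: if_splits)
  qed
  have less: "\<forall>x \<in> X. \<forall>y \<in> U. x < y" if "Max X < Min U" "X \<subseteq> V" "U \<subseteq> V" for X U
  proof (intro ballI)
    fix x y assume xy: "x \<in> X" "y \<in> U"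
    have "finite X" "finite U" using that V finite_subset by auto
    then have "x \<le> Max X" "Min U \<le> y" using xy by auto
    then show "x < y" using that by linarith
  qed
  \<comment> \<open>\<open>linked_run\<close> sees its block only through the maximum, which the
    union inherits from \<open>U\<close>.\<close>
  have merge: "linked_run b r (X \<union> U) R = linked_run b r U R"
    if "Max X < Min U" "finite X" "finite U" "X \<noteq> {}" "U \<noteq> {}" for X U R
  proof -
    have "Max X \<le> Max U" using that(1) Min_le[OF that(3) Max_in[OF that(3,5)]] by linarith
    then have "Max (X \<union> U) = Max U" using that by (simp add: Max_Un max_def)
    then show ?thesis by (simp add: linked_run_def)
  qed
  have b0: "b \<noteq> 0" using b_pos by simp
  have "inj_on f (run_pairs V s (Suc k))"
  proof (rule inj_onI, clarify)
    fix X Q X' Q'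
    assume XQ: "(X, Q) \<in> run_pairs V s (Suc k)" and XQ': "(X', Q') \<in> run_pairs V s (Suc k)"
      and eq: "f (X, Q) = f (X', Q')"
    obtain U R where 1: "Q = U # R" "Max X < Min U" "X \<subseteq> V" "card X = s" "U \<subseteq> V - X"
      using dom[OF XQ] by blast
    obtain U' R' where 2: "Q' = U' # R'" "Max X' < Min U'" "X' \<subseteq> V" "card X' = s" "U' \<subseteq> V - X'"
      using dom[OF XQ'] by blast
    have eqs: "X \<union> U = X' \<union> U'" "R = R'" using eq 1 2 by (auto simp: f_def)
    have "X = X'"
    proof (rule initial_segment_unique[OF _ _ _ eqs(1)])
      show "finite X" "finite X'" using 1 2 V finite_subset by auto
      show "\<forall>x \<in> X. \<forall>y \<in> U. x < y" using less[of X U] 1 by blast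
      show "\<forall>x \<in> X'. \<forall>y \<in> U'. x < y" using less[of X' U'] 2 by blast
    qed (use 1 2 in simp)
    moreover from this have "U = U'" using eqs(1) 1(5) 2(5) by blast
    ultimately show "X = X' \<and> Q = Q'" using 1 2 eqs by simp
  qed
  moreover have "f ` run_pairs V s (Suc k) = run_pairs V (s + b) k"
  proof (intro equalityI subsetI)
    fix p assume "p \<in> f ` run_pairs V s (Suc k)"
    then obtain X Q where XQ: "(X, Q) \<in> run_pairs V s (Suc k)" "p = f (X, Q)" by auto
    obtain U R where 1: "Q = U # R" "card U = b" "Max X < Min U" "linked_run b r U R = k"
      "X \<subseteq> V" "card X = s" "U \<subseteq> V - X" "osp (V - X - U) R" "rec_good b r S R"
      using dom[OF XQ(1)] by blast
    have fin: "finite X" "finite U" using 1 V finite_subset by blast+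
    have ne: "X \<noteq> {}" "U \<noteq> {}" using 1 s b0 by auto
    have "card (X \<union> U) = s + b" using 1 fin by (subst card_Un_disjoint) auto
    moreover have "V - (X \<union> U) = V - X - U" by auto
    ultimately show "p \<in> run_pairs V (s + b) k"
      using 1 XQ(2) merge[OF 1(3) fin ne] by (auto simp: run_pairs_def pairs_def good_osps_def f_def)
  next
    fix p assume "p \<in> run_pairs V (s + b) k"
    then obtain Y R where p: "p = (Y, R)" "Y \<subseteq> V" "card Y = s + b" "osp (V - Y) R" "rec_good b r S R"
      "linked_run b r Y R = k" by (auto simp: run_pairs_def pairs_def good_osps_def)
    have finY: "finite Y" using p(2) V finite_subset by blast
    obtain X where X: "X \<subseteq> Y" "card X = s" "\<And>x y. x \<in> X \<Longrightarrow> y \<in> Y - X \<Longrightarrow> x < y"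
      using obtain_initial_segment[OF finY, of s] p(3) by auto
    define U where "U = Y - X"
    have fin: "finite X" "finite U" using X(1) finY finite_subset by (auto simp: U_def)
    have U: "card U = b" using X p(3) fin by (simp add: U_def card_Diff_subset)
    have ne: "X \<noteq> {}" "U \<noteq> {}" using X U s b0 by auto
    have mx: "Max X < Min U" using X(3) fin ne by (simp add: U_def)
    have Y: "X \<union> U = Y" using X(1) by (auto simp: U_def)
    have lU: "linked_run b r U R = k" using merge[OF mx fin ne, of R] p(6) by (simp add: Y)
    have "V - X - U = V - Y" using Y by auto
    then have "osp (V - X) (U # R)" using p X ne by (auto simp: U_def)
    moreover have "rec_good b r S (U # R)" using rec_good_unit_Cons[OF U, of R] lU k p(5) by blast
    moreover have "linked_run b r X (U # R) = Suc k" using mx U lU k by (simp add: linked_run_def)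
    ultimately have "(X, U # R) \<in> run_pairs V s (Suc k)"
      using X p(2) by (auto simp: run_pairs_def pairs_def good_osps_def)
    moreover have "f (X, U # R) = p" using Y p(1) by (simp add: f_def)
    ultimately show "p \<in> f ` run_pairs V s (Suc k)" by force
  qed
  ultimately show ?thesis using card_image by metis
qed

lemma card_pairs:
  assumes "finite V"
  shows "card (pairs V s) = (\<Sum>k \<le> r - 1. card (run_pairs V s k))"
proof -
  have "pairs V s = (\<Union>k \<in> {..r - 1}. run_pairs V s k)"
    using linked_run_le by (auto simp: run_pairs_def)
  also have "card \<dots> = (\<Sum>k \<in> {..r - 1}. card (run_pairs V s k))"
    by (rule card_UN_disjoint) (use assms in \<open>auto simp: finite_run_pairs\<close>, auto simp: run_pairs_def)
  finally show ?thesis .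
qed

definition maxrun :: "nat set \<Rightarrow> nat \<Rightarrow> nat" where
  "maxrun V j = card (run_pairs V (oelt j) (r - 1))"

text \<open>Iterated merging absorbs the whole run into the block. With \<open>m = r - 1\<close> the
  size \<open>oelt j\<close> becomes \<open>eelt (Suc j)\<close>.\<close>

lemma card_run_pairs_shift:
  assumes V: "finite V" and s: "1 \<le> s"
  shows "m \<le> r - 1 \<Longrightarrow> card (run_pairs V s m) = card (run_pairs V (s + m * b) 0)"
  using s
proof (induction m arbitrary: s)
  case (Suc m)
  then have "card (run_pairs V s (Suc m)) = card (run_pairs V (s + b) m)"
    using card_run_pairs_merge[OF V] by simp
  then show ?case using Suc by (simp add: algebra_simps)
qed simp

text \<open>Both pair counts are split by run length. Merging matches run \<open>Suc k\<close> at
  \<open>eelt (Suc j)\<close> with run \<open>k\<close> at \<open>oelt (Suc j)\<close>. What remains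
  is the full run at \<open>oelt (Suc j)\<close> and the empty run at \<open>eelt (Suc j)\<close>;
  the latter counts as many pairs as the full run at \<open>oelt j\<close>.\<close>

lemma maxrun_Suc:
  assumes V: "finite V"
  shows "maxrun V j + card (pairs V (oelt (Suc j))) =
    maxrun V (Suc j) + card (pairs V (eelt (Suc j)))"
proof -
  have *: "{..r - 1} = insert (r - 1) {..<r - 1}" by auto
  have r1: "r - 1 = Suc (r - 2)" using r_ge_2 by simp
  have o: "1 \<le> oelt j" "1 \<le> eelt (Suc j)" using oelt_gt[of j] oelt_less_eelt[of j] by linarith+
  have "card (pairs V (oelt (Suc j))) =
      maxrun V (Suc j) + (\<Sum>k < r - 1. card (run_pairs V (oelt (Suc j)) k))"
    unfolding card_pairs[OF V] * by (simp add: maxrun_def)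
  moreover have "card (pairs V (eelt (Suc j))) =
      card (run_pairs V (eelt (Suc j)) 0) + (\<Sum>k < r - 1. card (run_pairs V (eelt (Suc j)) (Suc k)))"
    unfolding card_pairs[OF V] lessThan_Suc_atMost[symmetric] by (rule sum.lessThan_Suc_shift)
  moreover have "card (run_pairs V (eelt (Suc j)) 0) = maxrun V j"
    using card_run_pairs_shift[OF V o(1), of "r - 1"] by (simp add: maxrun_def eelt_Suc)
  moreover have "card (run_pairs V (eelt (Suc j)) (Suc k)) = card (run_pairs V (oelt (Suc j)) k)"
    if "k < r - 1" for k
    using card_run_pairs_merge[OF V o(2) that] by (simp add: oelt_eq)
  ultimately show ?thesis by simp
qed

end

section \<open>The recursion for the coefficients of the inverse series\<close>

lemma sum_reindex_of_bool:
  fixes h :: "nat \<Rightarrow> real"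
  assumes "inj f" "\<And>j. j \<le> f j" "A \<subseteq> range f" "\<And>i. n < i \<Longrightarrow> h i = 0"
  shows "(\<Sum>i\<le>n. of_bool (i \<in> A) * h i) = (\<Sum>j\<le>n. of_bool (f j \<in> A) * h (f j))"
proof -
  let ?g = "\<lambda>i. of_bool (i \<in> A) * h i"
  have "(\<Sum>j\<le>n. ?g (f j)) = sum ?g (f ` {..n})"
    using assms(1) by (subst sum.reindex) (auto intro: inj_on_subset)
  \<comment> \<open>Both sums are compared over the union of their index sets: values of
    \<open>f\<close> beyond \<open>n\<close> are killed by \<open>h\<close>, and a member of
    \<open>A\<close> up to \<open>n\<close> has its index up to \<open>n\<close> because
    \<open>j\<close> is at most \<open>f j\<close>.\<close>
  also have "\<dots> = sum ?g (f ` {..n} \<union> {..n})"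
  proof (rule sum.mono_neutral_left)
    show "\<forall>i \<in> (f ` {..n} \<union> {..n}) - f ` {..n}. ?g i = 0"
    proof
      fix i assume i: "i \<in> (f ` {..n} \<union> {..n}) - f ` {..n}"
      have "i \<notin> A"
      proof
        assume "i \<in> A"
        then obtain j where "i = f j" using assms(3) by auto
        then show False using i assms(2)[of j] by auto
      qed
      then show "?g i = 0" by simp
    qed
  qed auto
  also have "\<dots> = sum ?g {..n}"
    by (rule sum.mono_neutral_right) (auto simp: assms(4))
  finally show ?thesis ..
qed

text \<open>Coefficients are compared in the product of the series with its inverse. As 0 is in
  neither set, the constant coefficient is 1, so the inverse is genuine and the term
  \<open>i = 0\<close> isolates \<open>c n\<close>.\<close>

lemma inverse_egf_recursion:
  fixes c :: "nat \<Rightarrow> real"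
  assumes c: "inverse (1 - egf A + egf B) = Abs_fps (\<lambda>n. c n / fact n)"
    and "0 \<notin> A" "0 \<notin> B"
  shows "c 0 = 1"
    and "1 \<le> n \<Longrightarrow> c n = (\<Sum>i\<le>n. of_bool (i \<in> A) * (real (n choose i) * c (n - i))) -
           (\<Sum>i\<le>n. of_bool (i \<in> B) * (real (n choose i) * c (n - i)))"
proof -
  define F :: "real fps" where "F = 1 - egf A + egf B"
  have F0: "fps_nth F 0 = 1" using assms(2,3) by (simp add: F_def egf_def)
  have prod: "F * Abs_fps (\<lambda>n. c n / fact n) = 1"
    using inverse_mult_eq_1'[of F] F0 c by (simp add: F_def)
  from prod have "fps_nth (F * Abs_fps (\<lambda>n. c n / fact n)) 0 = 1" by simp
  then show "c 0 = 1" using F0 by simp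
  assume n: "1 \<le> n"
  have F: "fps_nth F i = of_bool (i = 0) - (of_bool (i \<in> A) - of_bool (i \<in> B)) / fact i" for i
    by (auto simp: F_def egf_def)
  from prod have "fps_nth (F * Abs_fps (\<lambda>n. c n / fact n)) n = 0" using n by simp
  \<comment> \<open>The factor \<open>fact n\<close> turns the quotients of factorials into binomial
    coefficients.\<close>
  then have "fact n * (\<Sum>i\<le>n. fps_nth F i * (c (n - i) / fact (n - i))) = 0"
    by (simp add: fps_mult_nth atLeast0AtMost)
  also have "fact n * (\<Sum>i\<le>n. fps_nth F i * (c (n - i) / fact (n - i))) =
      (\<Sum>i\<le>n. of_bool (i = 0) * c n -
        (of_bool (i \<in> A) * (real (n choose i) * c (n - i)) -
         of_bool (i \<in> B) * (real (n choose i) * c (n - i))))"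
    unfolding sum_distrib_left
  proof (rule sum.cong)
    fix i assume "i \<in> {..n}"
    then show "fact n * (fps_nth F i * (c (n - i) / fact (n - i))) = of_bool (i = 0) * c n -
        (of_bool (i \<in> A) * (real (n choose i) * c (n - i)) -
         of_bool (i \<in> B) * (real (n choose i) * c (n - i)))"
      by (cases "i = 0") (auto simp: F binomial_fact assms(2,3))
  qed simp
  also have "\<dots> = c n - ((\<Sum>i\<le>n. of_bool (i \<in> A) * (real (n choose i) * c (n - i))) -
         (\<Sum>i\<le>n. of_bool (i \<in> B) * (real (n choose i) * c (n - i))))"
    unfolding sum_subtractf by (simp add: sum_distrib_right[symmetric])
  finally show "c n = (\<Sum>i\<le>n. of_bool (i \<in> A) * (real (n choose i) * c (n - i))) -
         (\<Sum>i\<le>n. of_bool (i \<in> B) * (real (n choose i) * c (n - i)))" by simp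
qed

section \<open>Counting good partitions by their first block\<close>

context odd_ended_set
begin

text \<open>With this, the bottom criterion \<open>eelt j \<notin> S\<close> covers
  \<open>j = 0\<close> too, where \<open>oelt 0\<close> has no predecessor.\<close>

lemma eelt_0_notin: "eelt 0 \<notin> S"
  using S_subset oelt_gt[of 0] oelt_less_eelt[of 0] eelt_mono
  by (metis eelt_less_eelt_iff in_Nstar_iff nat.distinct(1) inj_eelt injD oelt_neq_eelt subsetD)

definition admissible_pairs :: "nat set \<Rightarrow> nat \<Rightarrow> (nat set \<times> nat set list) set" where
  "admissible_pairs V j =
     {(X, Q) \<in> pairs V (oelt j). admissible b r S (oelt j) (linked_run b r X Q)}"

text \<open>If both neighbours of \<open>oelt j\<close> are in \<open>S\<close>, no pair is
  admissible; if neither is, all are. With only the lower one, full runs are required; with only the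
  upper one, they are excluded. The coefficients encode these cases as differences, ready for
  summation by parts.\<close>

lemma card_admissible_pairs:
  assumes V: "finite V"
  shows "real (card (admissible_pairs V j)) =
    (of_bool (oelt j \<in> S) - of_bool (eelt j \<in> S)) * real (card (pairs V (oelt j))) +
    (of_bool (eelt j \<in> S) - of_bool (eelt (Suc j) \<in> S)) * real (maxrun V j)"
proof -
  have top: "top_el (oelt j) \<longleftrightarrow> oelt j \<in> S \<and> eelt (Suc j) \<notin> S" by (rule top_el_oelt)
  have bot: "bot_el (oelt j) \<longleftrightarrow> oelt j \<in> S \<and> eelt j \<notin> S"
    using bot_el_oelt[of j] eelt_0_notin by (cases j) auto
  have e1: "eelt (Suc j) \<in> S \<Longrightarrow> oelt j \<in> S" by (rule eelt_neighbours(2))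
  have e0: "eelt j \<in> S \<Longrightarrow> oelt j \<in> S" using eelt_neighbours(1) eelt_0_notin by (cases j) auto
  have lt: "linked_run b r X Q < r - 1 \<longleftrightarrow> linked_run b r X Q \<noteq> r - 1" for X Q
    using linked_run_le[of b r X Q] by auto
  have sub: "run_pairs V (oelt j) (r - 1) \<subseteq> pairs V (oelt j)" by (auto simp: run_pairs_def)
  consider "oelt j \<notin> S" | "oelt j \<in> S" "eelt j \<in> S" "eelt (Suc j) \<in> S"
    | "oelt j \<in> S" "eelt j \<notin> S" "eelt (Suc j) \<notin> S"
    | "oelt j \<in> S" "eelt j \<in> S" "eelt (Suc j) \<notin> S"
    | "oelt j \<in> S" "eelt j \<notin> S" "eelt (Suc j) \<in> S" by blast
  then show ?thesis
  proof cases
    case 1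
    then have "admissible_pairs V j = {}" using top bot by (auto simp: admissible_pairs_def admissible_def)
    then show ?thesis using 1 e0 e1 by auto
  next
    case 2
    then have "admissible_pairs V j = {}" using top bot by (auto simp: admissible_pairs_def admissible_def)
    then show ?thesis using 2 by simp
  next
    case 3
    then have "admissible_pairs V j = pairs V (oelt j)"
      using top bot by (auto simp: admissible_pairs_def admissible_def)
    then show ?thesis using 3 by simp
  next
    case 4
    then have "admissible_pairs V j = run_pairs V (oelt j) (r - 1)"
      using top bot linked_run_le
      by (auto simp: admissible_pairs_def admissible_def run_pairs_def intro: le_antisym)
    then show ?thesis using 4 by (simp add: maxrun_def)
  next
    case 5
    then have "admissible_pairs V j = pairs V (oelt j) - run_pairs V (oelt j) (r - 1)"
      using top bot lt by (auto simp: admissible_pairs_def admissible_def run_pairs_def)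
    then show ?thesis
      using 5 card_Diff_subset[OF finite_subset[OF sub finite_pairs[OF V]] sub]
        card_mono[OF finite_pairs[OF V] sub]
      by (simp add: maxrun_def of_nat_diff)
  qed
qed

lemma card_good_osps:
  assumes V: "finite V" "V \<noteq> {}"
  shows "card (good_osps V) = (\<Sum>j\<le>card V. card (admissible_pairs V j))"
proof -
  let ?f = "\<lambda>(X :: nat set, Q). X # Q"
  have "good_osps V = ?f ` (\<Union>j \<in> {..card V}. admissible_pairs V j)"
  proof (intro equalityI subsetI)
    fix P assume P: "P \<in> good_osps V"
    then obtain X Q where XQ: "P = X # Q" using V by (cases P) (auto simp: good_osps_def)
    then have g: "X \<subseteq> V" "osp (V - X) Q" "rec_good b r S Q" "admissible b r S (card X) (linked_run b r X Q)"
      using P by (auto simp: good_osps_def)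
    then obtain j where j: "card X = oelt j"
      using top_el_Ostar bot_el_Ostar in_Ostar_iff unfolding admissible_def by blast
    \<comment> \<open>The truncation at \<open>card V\<close> loses nothing, since
      \<open>j < oelt j\<close> and \<open>oelt j\<close> is the size of a subset of
      \<open>V\<close>.\<close>
    moreover have "j \<le> card V" using oelt_gt[of j] j card_mono[OF V(1) g(1)] by simp
    ultimately have "(X, Q) \<in> (\<Union>j \<in> {..card V}. admissible_pairs V j)"
      using g by (auto simp: admissible_pairs_def pairs_def good_osps_def)
    then show "P \<in> ?f ` (\<Union>j \<in> {..card V}. admissible_pairs V j)" using XQ by force
  next
    fix P assume "P \<in> ?f ` (\<Union>j \<in> {..card V}. admissible_pairs V j)"
    then obtain X Q j where XQ: "P = X # Q" "(X, Q) \<in> admissible_pairs V j" by auto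
    then have "card X = oelt j" by (auto simp: admissible_pairs_def pairs_def)
    then have "X \<noteq> {}" using oelt_gt[of j] by auto
    then show "P \<in> good_osps V"
      using XQ by (auto simp: good_osps_def admissible_pairs_def pairs_def)
  qed
  moreover have "inj_on ?f D" for D by (auto simp: inj_on_def)
  ultimately have "card (good_osps V) = card (\<Union>j \<in> {..card V}. admissible_pairs V j)"
    by (simp add: card_image)
  also have "\<dots> = (\<Sum>j\<le>card V. card (admissible_pairs V j))"
  proof (rule card_UN_disjoint)
    show "\<forall>j \<in> {..card V}. finite (admissible_pairs V j)"
      using finite_pairs[OF V(1)] finite_subset unfolding admissible_pairs_def
      by (metis (no_types, lifting) case_prodE mem_Collect_eq subsetI)
    show "\<forall>i \<in> {..card V}. \<forall>j \<in> {..card V}. i \<noteq> j \<longrightarrow> admissible_pairs V i \<inter> admissible_pairs V j = {}"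
      using inj_oelt by (auto simp: admissible_pairs_def pairs_def dest: injD)
  qed simp
  finally show ?thesis .
qed

text \<open>Summation by parts: the coefficients of the maximal-run counts telescope
  by \<open>maxrun_Suc\<close>.\<close>

lemma sum_card_admissible_pairs:
  assumes V: "finite V"
  shows "(\<Sum>j\<le>m. real (card (admissible_pairs V j))) =
    (\<Sum>j\<le>m. of_bool (oelt j \<in> S) * real (card (pairs V (oelt j)))) -
    (\<Sum>j\<le>m. of_bool (eelt j \<in> S) * real (card (pairs V (eelt j)))) -
    of_bool (eelt (Suc m) \<in> S) * real (maxrun V m)"
proof (induction m)
  case 0
  then show ?case using eelt_0_notin card_admissible_pairs[OF V, of 0] by simp
next
  case (Suc m)
  have "real (maxrun V m) + real (card (pairs V (oelt (Suc m)))) =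
      real (maxrun V (Suc m)) + real (card (pairs V (eelt (Suc m))))"
    using maxrun_Suc[OF V, of m] by (metis of_nat_add)
  then show ?case
    using Suc card_admissible_pairs[OF V, of "Suc m"]
    by (cases "eelt (Suc m) \<in> S") (auto simp: algebra_simps)
qed

text \<open>Every choice of \<open>X\<close> leaves a strictly smaller set of the same size, to
  which the induction hypothesis applies.\<close>

lemma card_pairs_eq:
  fixes c :: "nat \<Rightarrow> real"
  assumes V: "finite V" and s: "1 \<le> s"
    and IH: "\<And>W. finite W \<Longrightarrow> card W < card V \<Longrightarrow> real (card (good_osps W)) = c (card W)"
  shows "real (card (pairs V s)) = real (card V choose s) * c (card V - s)"
proof -
  let ?D = "{X. X \<subseteq> V \<and> card X = s}"
  have "finite ?D" using V by auto
  then have "real (card (pairs V s)) = (\<Sum>X \<in> ?D. real (card (good_osps (V - X))))"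
    unfolding pairs_def using V by (subst card_SigmaI) (auto simp: finite_good_osps)
  also have "\<dots> = (\<Sum>X \<in> ?D. c (card V - s))"
  proof (rule sum.cong)
    fix X assume X: "X \<in> ?D"
    then have "card (V - X) = card V - s" "card V \<ge> s"
      using V finite_subset[of X V] card_mono[of V X] by (auto simp: card_Diff_subset)
    then show "real (card (good_osps (V - X))) = c (card V - s)"
      using IH[of "V - X"] V s by simp
  qed simp
  also have "\<dots> = real (card V choose s) * c (card V - s)"
    by (simp add: n_subsets[OF V])
  finally show ?thesis .
qed

lemma card_good_osps_eq:
  fixes c :: "nat \<Rightarrow> real"
  assumes S: "S = A \<union> B" "A \<subseteq> Ostar b r" "B \<subseteq> Estar b r"
    and c: "inverse (1 - egf A + egf B) = Abs_fps (\<lambda>n. c n / fact n)"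
  shows "finite V \<Longrightarrow> real (card (good_osps V)) = c (card V)"
proof (induction "card V" arbitrary: V rule: less_induct)
  case less
  have inA: "oelt j \<in> S \<longleftrightarrow> oelt j \<in> A" and inB: "eelt j \<in> S \<longleftrightarrow> eelt j \<in> B" for j
    using S oelt_neq_eelt in_Ostar_iff in_Estar_iff by (metis Un_iff subsetD)+
  have A: "A \<subseteq> range oelt" using S(2) in_Ostar_iff by blast
  have B: "B \<subseteq> range eelt" using S(3) in_Estar_iff by blast
  have "0 \<notin> S" using eelt_0_notin by (simp add: eelt_def)
  then have "0 \<notin> A" "0 \<notin> B" using S by auto
  note rec = inverse_egf_recursion[OF c this]
  show ?case
  proof (cases "V = {}")
    case True
    have "osp {} P \<and> rec_good b r S P \<longleftrightarrow> P = []" for P by (cases P) auto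
    then have "good_osps V = {[]}" by (simp add: True good_osps_def)
    then show ?thesis using True rec(1) by simp
  next
    case False
    define n where "n = card V"
    define h where "h = (\<lambda>i. real (n choose i) * c (n - i))"
    have h0: "n < i \<Longrightarrow> h i = 0" for i by (simp add: h_def)
    have n: "1 \<le> n" using False less(2) by (simp add: n_def Suc_le_eq card_gt_0_iff)
    have h: "real (card (pairs V s)) = h s" if "1 \<le> s" for s
      unfolding h_def n_def by (rule card_pairs_eq[OF less(2) that less(1)])
    \<comment> \<open>The boundary term of the summation by parts vanishes: a block of size
      \<open>oelt n\<close> exceeds \<open>V\<close>.\<close>
    have "maxrun V n = 0"
    proof -
      have "card X \<noteq> oelt n" if "X \<subseteq> V" for X
        using card_mono[OF less(2) that] oelt_gt[of n] by (simp add: n_def)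
      then have "{X. X \<subseteq> V \<and> card X = oelt n} = {}" by blast
      then have "pairs V (oelt n) = {}" by (simp only: pairs_def Sigma_empty1)
      then show ?thesis by (simp add: maxrun_def run_pairs_def)
    qed
    moreover have "real (card (good_osps V)) = (\<Sum>j\<le>n. real (card (admissible_pairs V j)))"
      using card_good_osps[OF less(2) False] by (simp add: n_def)
    ultimately have "real (card (good_osps V)) =
      (\<Sum>j\<le>n. of_bool (oelt j \<in> S) * real (card (pairs V (oelt j)))) -
      (\<Sum>j\<le>n. of_bool (eelt j \<in> S) * real (card (pairs V (eelt j))))"
      using sum_card_admissible_pairs[OF less(2), of n] by simp
    also have "(\<Sum>j\<le>n. of_bool (oelt j \<in> S) * real (card (pairs V (oelt j)))) =
        (\<Sum>j\<le>n. of_bool (oelt j \<in> A) * h (oelt j))"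
    proof (rule sum.cong)
      fix j
      have "1 \<le> oelt j" using oelt_gt[of j] by simp
      then show "of_bool (oelt j \<in> S) * real (card (pairs V (oelt j))) = of_bool (oelt j \<in> A) * h (oelt j)"
        using h inA by simp
    qed simp
    also have "\<dots> = (\<Sum>i\<le>n. of_bool (i \<in> A) * h i)"
      using oelt_gt less_imp_le by (intro sum_reindex_of_bool[OF inj_oelt _ A h0, symmetric]) blast+
    also have "(\<Sum>j\<le>n. of_bool (eelt j \<in> S) * real (card (pairs V (eelt j)))) =
        (\<Sum>j\<le>n. of_bool (eelt j \<in> B) * h (eelt j))"
    proof (rule sum.cong)
      fix j
      \<comment> \<open>The formula for pair counts requires a positive size; the index 0 drops out
        because \<open>eelt 0\<close> is not in \<open>S\<close>.\<close>
      have "1 \<le> eelt j" if "eelt j \<in> S" using that \<open>0 \<notin> S\<close> by (cases "eelt j") auto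
      then show "of_bool (eelt j \<in> S) * real (card (pairs V (eelt j))) = of_bool (eelt j \<in> B) * h (eelt j)"
        using h inB by auto
    qed simp
    also have "\<dots> = (\<Sum>i\<le>n. of_bool (i \<in> B) * h i)"
    proof (rule sum_reindex_of_bool[OF inj_eelt _ B h0, symmetric])
      fix j show "j \<le> eelt j"
        using oelt_gt[of "j - 1"] oelt_less_eelt[of "j - 1"] by (cases j) auto
    qed
    finally show ?thesis using rec(2)[OF n] by (simp add: h_def n_def)
  qed
qed

end

theorem theorem1p5:
  fixes b r :: nat and A B :: "nat set" and c :: "nat \<Rightarrow> real"
  assumes "1 \<le> b" and "2 \<le> r"
    and "A \<subseteq> Ostar b r" and "B \<subseteq> Estar b r"
    and "b \<in> A"
    and "odd_ended b r (A \<union> B)"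
    and "inverse (1 - egf A + egf B) = Abs_fps (\<lambda>n. c n / fact n)"
  shows "\<forall>n. c n \<in> \<int> \<and> 0 \<le> c n \<and>
           c n = real (card {P. ordered_set_partition n P \<and> good b r (A \<union> B) P})"
proof -
  interpret odd_ended_set b r "A \<union> B"
    using assms by unfold_locales (auto simp: Nstar_def)
  have "c n = real (card {P. ordered_set_partition n P \<and> good b r (A \<union> B) P})" for n
    using card_good_osps_eq[OF refl assms(3,4,7), of "{1..n}"]
    by (simp add: good_osps_def good_iff_rec_good ordered_set_partition_eq_osp)
  then show ?thesis by simp
qed

end
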